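(* Let $\ell\ge3$ and $1\le t\le\ell-1$ be integers, $n=2^\ell$ and $k=k_\ell-\sum_{i=1}^{\ell-t}f_\ell(i)$, where $k_\ell=\sum_{i=1}^{\ell}f_\ell(i)$. Then the modified encoding map $\psi_t:\{0,1\}^{k}\to\{0,1\}^{n}$ is one-to-one and every vector in its image has Hamming weight $t$; hence $\mathcal{D}_t[\ell]=\psi_t(\{0,1\}^k)$ is a binary constant weight code of blocklength $2^\ell$, weight $t$ and size $2^k$.
   Context: The sequence $f_\ell$: if $\ell$ is not a power of $2$, put $\mu = 2^{\lceil \log_2 \ell\rceil} - \ell$ and $f_\ell(i) = \ell - \lceil \log_2\ell\rceil$ for $1\le i\le \ell-\mu$; $f_\ell(i) = \ell - \lfloor \log_2\ell\rfloor$ for $\ell-\mu+1\le i\le \ell-1$; $f_\ell(\ell)=\ell$. If $\ell$ is a power of $2$, put $f_\ell(1) = \ell-\log_2\ell-1$; $f_\ell(i)=\ell-\log_2\ell$ for $2\le i\le \ell-1$; $f_\ell(\ell)=\ell$. For a binary vector $\mathbf{y}$, $\mathrm{dec}(\mathbf{y})$ is its decimal value, most significant bit first. Modified encoding map $\psi_t$: write the message as $\mathbf{x}_\ell\Vert\mathbf{x}_{\ell-1}\Vert\cdots\Vert\mathbf{x}_{\ell-t+1}$ (concatenation) with $|\mathbf{x}_i|=f_\ell(i)$, and let $\mathbf{x}_{\ell-t},\dots,\mathbf{x}_1$ be all-zero vectors with $|\mathbf{x}_i|=f_\ell(i)$. Start with $\mathbf{c}=0^n$ (coordinates indexed $0,\dots,n-1$)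 and $\mathrm{pos}=-1$. For $j=\ell,\ell-1,\dots,1$ in this order, replace $\mathrm{pos}$ by $(\mathrm{pos}+1+\mathrm{dec}(\mathbf{x}_j)) \bmod n$ and set $c[\mathrm{pos}]=1$. Finally, reset to $0$ the bits of $\mathbf{c}$ that were set to $1$ in the last $\ell-t$ iterations (those for $j=\ell-t,\dots,1$). The resulting $\mathbf{c}$ is the output of $\psi_t$. *)

theory Defs
  imports Complex_Main "HOL-Library.FuncSet"
begin

(* Binary vectors are bool lists; coordinate i of c is c ! i, i = 0, ..., length c - 1. *)

definition binvecs :: "nat \<Rightarrow> bool list set" where
  "binvecs n = {v. length v = n}"

definition hamming_weight :: "bool list \<Rightarrow> nat" where
  "hamming_weight c = card {i. i < length c \<and> c ! i}"

definition constant_weight_code :: "bool list set \<Rightarrow> nat \<Rightarrow> nat \<Rightarrow> bool" where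
  "constant_weight_code C n w \<longleftrightarrow> C \<subseteq> {c \<in> binvecs n. hamming_weight c = w}"

(* horner_sum reads the least significant digit first, hence the reversal. *)
definition dec :: "bool list \<Rightarrow> nat" where
  "dec y = horner_sum of_bool 2 (rev y)"

(* The relevant range is l >= 3 and 1 <= i <= l, where no subtraction truncates.
   If l is a power of 2, the floor of log 2 l is log 2 l itself. *)
definition f_seq :: "nat \<Rightarrow> nat \<Rightarrow> nat" where
  "f_seq l i =
    (if \<exists>m. l = 2 ^ m then
       (if i = l then l
        else if i = 1 then l - nat \<lfloor>log 2 (real l)\<rfloor> - 1
        else l - nat \<lfloor>log 2 (real l)\<rfloor>)
     else
       (let \<mu> = 2 ^ nat \<lceil>log 2 (real l)\<rceil> - l in
        if i = l then l
        else if i \<le> l - \<mu> then l - nat \<lceil>log 2 (real l)\<rceil>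
        else l - nat \<lfloor>log 2 (real l)\<rfloor>))"

(* The block x_j. The message is the concatenation of x_l, x_(l-1), ..., x_(l-t+1)
   in this order, so x_j is preceded by x_l, ..., x_(j+1). *)
definition block :: "nat \<Rightarrow> nat \<Rightarrow> bool list \<Rightarrow> nat \<Rightarrow> bool list" where
  "block l t m j =
    (if l - t < j then take (f_seq l j) (drop (\<Sum>i = j + 1..l. f_seq l i) m)
     else replicate (f_seq l j) False)"

(* The value of pos after the first s iterations, i.e. those for j = l, ..., l - s + 1. *)
primrec pos_after :: "nat \<Rightarrow> (nat \<Rightarrow> bool list) \<Rightarrow> nat \<Rightarrow> int" where
  "pos_after l x 0 = - 1"
| "pos_after l x (Suc s) = (pos_after l x s + 1 + int (dec (x (l - s)))) mod 2 ^ l"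

(* The coordinate set to 1 in iteration j; from the first iteration on, pos is nonnegative. *)
definition bit_pos :: "nat \<Rightarrow> (nat \<Rightarrow> bool list) \<Rightarrow> nat \<Rightarrow> nat" where
  "bit_pos l x j = nat (pos_after l x (l - j + 1))"

definition psi :: "nat \<Rightarrow> nat \<Rightarrow> bool list \<Rightarrow> bool list" where
  "psi l t m =
    (let x = block l t m;
         c = fold (\<lambda>j c. c[bit_pos l x j := True]) (rev [1..<l + 1]) (replicate (2 ^ l) False)
     in fold (\<lambda>j c. c[bit_pos l x j := False]) (rev [1..<l - t + 1]) c)"

end

theory Submission
  imports Defs
begin

text \<open>
  The gap between consecutive retained bits \<open>j + 1\<close> and \<open>j\<close> is \<open>1 + dec x\<^sub>j \<le> 2 ^ f\<^sub>l j \<le> G\<close>, and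
  the sequence \<open>f\<^sub>l\<close> satisfies \<open>\<Sum>\<^sub>j\<^sub><\<^sub>l 2 ^ f\<^sub>l j + G \<le> 2 ^ l\<close>. So the \<open>l\<close> positions are distinct.
  As \<open>t < l\<close>, the gap that runs cyclically from the last retained bit back to the first one exceeds
  \<open>G\<close>, so the first bit is the only one without another retained bit among its \<open>G\<close> cyclic
  predecessors. This recovers \<open>x\<^sub>l\<close>, and reading the gaps from there recovers the other blocks.
\<close>

section \<open>The exponents \<open>f_seq\<close>: a Kraft-type inequality\<close>

text \<open>\<open>G\<close> will bound every gap between consecutive retained bits, and it is also
  the room left on the cycle of length \<open>2 ^ l\<close> beyond all the gaps. The witness is the
  largest value that \<open>2 ^ f_seq l j\<close> is allowed to take for
  \<open>j < l\<close>.\<close>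

lemma f_seq_gap_bound:
  assumes "l \<ge> 3"
  shows "\<exists>G. (\<forall>j\<in>{1..<l}. 2 ^ f_seq l j \<le> G) \<and> (\<Sum>j\<in>{1..<l}. 2 ^ f_seq l j) + G \<le> (2::nat) ^ l"
proof (cases "\<exists>m. l = 2 ^ m")
  case True
  then obtain m where m: "l = 2 ^ m" by blast
  have "log 2 (real l) = real m" by (simp add: m log_nat_power)
  then have fl: "nat \<lfloor>log 2 (real l)\<rfloor> = m" by simp
  have ml: "m < l" using m by simp
  have f: "f_seq l j = (if j = 1 then l - m - 1 else l - m)" if "j \<in> {1..<l}" for j
    using that True fl by (auto simp: f_seq_def)
  have pw: "(2::nat) ^ l = l * 2 ^ (l - m)"
    using ml m by (metis le_add_diff_inverse less_imp_le power_add)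
  define g where "g = (2::nat) ^ (l - m)"
  have half: "(2::nat) ^ (l - m - 1) \<le> g" by (simp add: g_def power_increasing)
  \<comment> \<open>The smaller exponent at \<open>j = 1\<close> is estimated by \<open>g\<close>
    too; then \<open>l - 1\<close> summands and the extra \<open>g\<close> make
    \<open>l * g = 2 ^ l\<close>.\<close>
  have "(\<Sum>j\<in>{1..<l}. (2::nat) ^ f_seq l j) \<le> (\<Sum>j\<in>{1..<l}. g)"
    using half by (intro sum_mono) (auto simp: f g_def)
  also have "\<dots> + g = 2 ^ l"
    unfolding pw using assms by (cases l) (simp_all add: g_def)
  finally have "(\<Sum>j\<in>{1..<l}. (2::nat) ^ f_seq l j) + g \<le> 2 ^ l" by simp
  moreover have "\<forall>j\<in>{1..<l}. 2 ^ f_seq l j \<le> g"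
    using half by (auto simp: f g_def)
  ultimately show ?thesis by blast
next
  case False
  define c where "c = nat \<lceil>log 2 (real l)\<rceil>"
  define b where "b = nat \<lfloor>log 2 (real l)\<rfloor>"
  have pos: "0 \<le> log 2 (real l)" using assms by simp
  have "real b \<le> log 2 (real l)" "log 2 (real l) < real b + 1"
    using pos by (auto simp: b_def of_nat_nat)
  then have "2 powr real b \<le> real l" "real l < 2 powr real (b + 1)"
    using assms by (simp_all add: le_log_iff log_less_iff add.commute)
  then have "real (2 ^ b) \<le> real l" "real l < real (2 ^ (b + 1))"
    using powr_realpow [of 2 b] powr_realpow [of 2 "b + 1"] by simp_all
  then have "2 ^ b \<le> l" and lt: "l < 2 ^ (b + 1)"
    by (simp_all only: of_nat_le_iff of_nat_less_iff)
  \<comment> \<open>Strictness, from \<open>l\<close> not being a power of 2, is what makes the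
    ceiling \<open>b + 1\<close> rather than \<open>b\<close>.\<close>
  then have gt: "2 ^ b < l" using False by (metis le_neq_implies_less)
  then have "real (2 ^ b) < real l" by (simp only: of_nat_less_iff)
  then have "real b < log 2 (real l)"
    using assms by (simp add: less_log_iff powr_realpow)
  with \<open>log 2 (real l) < real b + 1\<close> have "\<lceil>log 2 (real l)\<rceil> = int b + 1"
    by (intro ceiling_unique) auto
  then have c: "c = b + 1" by (simp add: c_def)
  have cl: "c \<le> l"
  proof -
    have "b < 2 ^ b" by simp
    with gt c show ?thesis by linarith
  qed
  define u where "u = 2 ^ c - l"
  have u: "u > 0" "u < l" "l + u = 2 ^ c"
    using lt gt by (auto simp: u_def c)
  define h where "h = (2::nat) ^ (l - c)"
  have "l - b = Suc (l - c)" using c cl by simp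
  then have h2: "(2::nat) ^ (l - b) = 2 * h" by (simp add: h_def)
  have pw: "(2::nat) ^ l = (l + u) * h"
    using cl by (simp add: u h_def flip: power_add)
  have f: "(2::nat) ^ f_seq l j = (if j \<le> l - u then h else 2 * h)" if "j \<in> {1..<l}" for j
    using that False h2 by (auto simp: f_seq_def Let_def c_def [symmetric] b_def [symmetric]
      u_def [symmetric] h_def)
  have split: "{1..<l} = {1..l - u} \<union> {l - u<..<l}"
    using u by auto
  have "(\<Sum>j\<in>{1..<l}. (2::nat) ^ f_seq l j) = (\<Sum>j\<in>{1..<l}. if j \<le> l - u then h else 2 * h)"
    by (intro sum.cong refl f)
  also have "\<dots> = (\<Sum>j\<in>{1..l - u}. h) + (\<Sum>j\<in>{l - u<..<l}. 2 * h)"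
    unfolding split by (subst sum.union_disjoint) (auto intro!: sum.cong)
  \<comment> \<open>There are \<open>l - u\<close> summands \<open>h\<close> and
    \<open>u - 1\<close> summands \<open>2 * h\<close>; one more \<open>2 * h\<close> gives
    \<open>(l + u) * h\<close>.\<close>
  also have "\<dots> + 2 * h = 2 ^ l"
  proof -
    obtain v w where "u = Suc v" "l = Suc v + w" using u by (metis Suc_pred less_imp_add_positive)
    then show ?thesis unfolding pw by (simp add: algebra_simps)
  qed
  finally have "(\<Sum>j\<in>{1..<l}. (2::nat) ^ f_seq l j) + 2 * h = 2 ^ l" .
  moreover have "\<forall>j\<in>{1..<l}. 2 ^ f_seq l j \<le> 2 * h"
    by (auto simp: f)
  ultimately show ?thesis by (metis order_refl)
qed

section \<open>Binary values and iterated list updates\<close>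

lemma f_seq_self [simp]: "f_seq l l = l"
  by (simp add: f_seq_def Let_def)

lemma dec_less: "dec y < 2 ^ length y"
  unfolding dec_def by (metis horner_sum_of_bool_2_less length_rev)

text \<open>Bit \<open>i\<close> of \<open>dec x\<close> is entry \<open>i\<close> of
  \<open>rev x\<close>; equal lengths rule out a difference in leading zeros.\<close>

lemma dec_eq_iff:
  assumes "length x = length y"
  shows "dec x = dec y \<longleftrightarrow> x = y"
proof
  assume eq: "dec x = dec y"
  have "rev x = rev y"
  proof (intro nth_equalityI)
    fix i assume "i < length (rev x)"
    then show "rev x ! i = rev y ! i"
      using eq assms bit_horner_sum_bit_iff [where ?'a = nat, of "rev x" i]
        bit_horner_sum_bit_iff [where ?'a = nat, of "rev y" i]
      by (simp add: dec_def)
  qed (use assms in simp)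
  then show "x = y" by simp
qed simp

lemma length_fold_list_update [simp]:
  "length (fold (\<lambda>j c. c[p j := v]) xs c) = length c"
  by (induction xs arbitrary: c) auto

lemma nth_fold_list_update:
  assumes "i < length c"
  shows "fold (\<lambda>j c. c[p j := v]) xs c ! i = (if i \<in> p ` set xs then v else c ! i)"
  using assms by (induction xs arbitrary: c) auto

section \<open>Recovering a start point and gaps from a set of residues\<close>

lemma add_mod_cancel_left:
  fixes a x y n :: nat
  assumes eq: "(a + x) mod n = (a + y) mod n" and "x < n" "y < n"
  shows "x = y"
proof -
  have "v \<le> u" if "(a + u) mod n = (a + v) mod n" "v < n" for u v
  proof (rule ccontr)
    assume "\<not> v \<le> u"
    then have "n dvd v - u"
      using that mod_eq_dvd_iff_nat [of "a + u" "a + v" n] by simp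
    then show False
      using \<open>\<not> v \<le> u\<close> \<open>v < n\<close> by (auto dest: dvd_imp_le)
  qed
  from this [OF eq] this [OF eq [symmetric]] show ?thesis
    using assms(2,3) by simp
qed

text \<open>Both enumerations, read as lists, are the strictly sorted list of the same set.\<close>

lemma strict_mono_enumeration_unique:
  fixes e e' :: "nat \<Rightarrow> nat"
  assumes "strict_mono_on {..<t} e" "strict_mono_on {..<t} e'"
    and "e ` {..<t} = e' ` {..<t}" and "s < t"
  shows "e s = e' s"
proof -
  have "sorted_wrt (<) (map e [0..<t])" "sorted_wrt (<) (map e' [0..<t])"
    using assms(1,2) by (auto simp: sorted_wrt_iff_nth_less strict_mono_on_def)
  moreover have "set (map e [0..<t]) = set (map e' [0..<t])"
    using assms(3) by (simp add: atLeast0LessThan)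
  ultimately have "map e [0..<t] = map e' [0..<t]"
    by (intro strict_sorted_equal) simp_all
  then show ?thesis using \<open>s < t\<close> by simp
qed

text \<open>If \<open>a\<close> were a later point of the second family, its predecessor there would
  lie at most \<open>G\<close> before \<open>a\<close>. That point also belongs to the first family,
  whose points all lie more than \<open>G\<close> before the return to \<open>a\<close>.\<close>

lemma cyclic_positions_unique:
  fixes e e' :: "nat \<Rightarrow> nat"
  assumes start: "a < n" "a' < n" "e 0 = 0" "e' 0 = 0" "0 < t"
    and mono: "strict_mono_on {..<t} e" "strict_mono_on {..<t} e'"
    and gap: "\<And>s. Suc s < t \<Longrightarrow> e' (Suc s) \<le> e' s + G"
    and wrap: "\<And>s. s < t \<Longrightarrow> e s + G < n" "\<And>s. s < t \<Longrightarrow> e' s < n"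
    and eq: "(\<lambda>s. (a + e s) mod n) ` {..<t} = (\<lambda>s. (a' + e' s) mod n) ` {..<t}"
  shows "a = a' \<and> (\<forall>s<t. e s = e' s)"
proof -
  have "(a + e 0) mod n \<in> (\<lambda>s. (a' + e' s) mod n) ` {..<t}"
    using eq start by blast
  then obtain s where s: "s < t" "a = (a' + e' s) mod n"
    using start by auto
  have aa: "a = a'"
  proof (cases s)
    case 0
    then show ?thesis using s start by simp
  next
    case (Suc r)
    define d where "d = e' s - e' r"
    have "e' r < e' s" using mono(2) Suc s by (auto simp: strict_mono_on_def)
    then have d: "e' s = e' r + d" "0 < d" "d \<le> G"
      using gap [of r] Suc s by (auto simp: d_def)
    have "(a' + e' r) mod n \<in> (\<lambda>s. (a + e s) mod n) ` {..<t}"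
      using eq Suc s by auto
    then obtain v where v: "v < t" "(a' + e' r) mod n = (a + e v) mod n" by auto
    \<comment> \<open>Going from \<open>a\<close> to the common point and on by \<open>d\<close>
      returns to \<open>a\<close>, although \<open>0 < e v + d < n\<close>.\<close>
    have "(a + 0) mod n = (a' + e' r + d) mod n" using s d by (simp add: add.assoc)
    also have "\<dots> = (a + (e v + d)) mod n"
      using v(2) by (metis add.assoc mod_add_left_eq)
    finally have "0 = e v + d"
      by (rule add_mod_cancel_left) (use wrap(1) [OF v(1)] d start in auto)
    with d show ?thesis by simp
  qed
  have "inj_on (\<lambda>x. (a + x) mod n) {..<n}"
    by (auto intro!: inj_onI dest: add_mod_cancel_left)
  moreover have "e ` {..<t} \<subseteq> {..<n}" "e' ` {..<t} \<subseteq> {..<n}"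
    using wrap by (auto dest: add_lessD1)
  moreover have "(\<lambda>x. (a + x) mod n) ` e ` {..<t} = (\<lambda>x. (a + x) mod n) ` e' ` {..<t}"
    using eq aa by (simp add: image_image)
  ultimately have "e ` {..<t} = e' ` {..<t}"
    by (simp add: inj_on_image_eq_iff)
  with mono aa show ?thesis
    using strict_mono_enumeration_unique by blast
qed

section \<open>Positions as reduced partial sums of gaps\<close>

text \<open>The unreduced distance from the bit of iteration \<open>j = l\<close> to the bit set
  \<open>s\<close> iterations later. The block \<open>x l\<close> is left out, as it fixes the start
  point.\<close>

definition offset :: "nat \<Rightarrow> (nat \<Rightarrow> bool list) \<Rightarrow> nat \<Rightarrow> nat" where
  "offset l x s = (\<Sum>i = 1..s. 1 + dec (x (l - i)))"

lemma offset_0 [simp]: "offset l x 0 = 0"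
  and offset_Suc [simp]: "offset l x (Suc s) = offset l x s + 1 + dec (x (l - Suc s))"
  by (simp_all add: offset_def)

lemma strict_mono_offset: "strict_mono (offset l x)"
  by (simp add: strict_mono_Suc_iff)

text \<open>The initial \<open>- 1\<close> cancels the \<open>+ 1\<close> of the first iteration,
  and all reductions can be deferred to the end.\<close>

lemma pos_after_Suc: "pos_after l x (Suc s) = int ((dec (x l) + offset l x s) mod 2 ^ l)"
proof (induction s)
  case (Suc s)
  show ?case
    using mod_add_left_eq [of "int (dec (x l) + offset l x s)" "2 ^ l" "1 + int (dec (x (l - Suc s)))"]
    unfolding pos_after.simps(2) [of l x "Suc s"] Suc by (simp add: zmod_int add_ac)
qed (simp add: zmod_int)

lemma bit_pos_eq: "bit_pos l x j = (dec (x l) + offset l x (l - j)) mod 2 ^ l"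
  by (simp only: bit_pos_def Suc_eq_plus1 [symmetric] pos_after_Suc nat_int)

lemma offset_le:
  assumes "\<And>j. 1 \<le> j \<Longrightarrow> j < l \<Longrightarrow> length (x j) = f_seq l j" and "s < l"
  shows "offset l x s \<le> (\<Sum>j\<in>{l - s..<l}. 2 ^ f_seq l j)"
  using \<open>s < l\<close>
proof (induction s)
  case (Suc s)
  have "{l - Suc s..<l} = insert (l - Suc s) {l - s..<l}" using Suc.prems by auto
  moreover have "1 + dec (x (l - Suc s)) \<le> 2 ^ f_seq l (l - Suc s)"
    using dec_less [of "x (l - Suc s)"] assms(1) [of "l - Suc s"] Suc.prems by simp
  ultimately show ?case using Suc by simp
qed simp

section \<open>Cutting the message into blocks\<close>

text \<open>Ensures that \<open>take\<close> in \<open>block\<close> never runs past the end of the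
  message.\<close>

lemma sum_f_seq_prefix:
  assumes "l - t < j" "j \<le> l" "t \<le> l"
  shows "(\<Sum>i = j + 1..l. f_seq l i) + f_seq l j \<le> (\<Sum>i = l - t + 1..l. f_seq l i)"
proof -
  have "(\<Sum>i = j + 1..l. f_seq l i) + f_seq l j = (\<Sum>i = j..l. f_seq l i)"
    using assms by (simp add: sum.atLeast_Suc_atMost)
  also have "\<dots> \<le> (\<Sum>i = l - t + 1..l. f_seq l i)"
    using assms by (intro sum_mono2) auto
  finally show ?thesis .
qed

lemma length_block:
  assumes "length m = (\<Sum>i = l - t + 1..l. f_seq l i)" "j \<le> l" "t \<le> l"
  shows "length (block l t m j) = f_seq l j"
  using assms sum_f_seq_prefix [of l t j] by (auto simp: block_def)

text \<open>Induction on the number of leading blocks: each further block extends the common prefix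
  of the messages.\<close>

lemma block_inject:
  assumes "length m = (\<Sum>i = l - t + 1..l. f_seq l i)" "length m' = length m" "t \<le> l"
    and "\<And>j. l - t < j \<Longrightarrow> j \<le> l \<Longrightarrow> block l t m j = block l t m' j"
  shows "m = m'"
proof -
  have "take (\<Sum>i = l - s + 1..l. f_seq l i) m = take (\<Sum>i = l - s + 1..l. f_seq l i) m'"
    if "s \<le> t" for s
    using that
  proof (induction s)
    case (Suc s)
    have *: "(\<Sum>i = l - Suc s + 1..l. f_seq l i) = (\<Sum>i = l - s + 1..l. f_seq l i) + f_seq l (l - s)"
      using Suc.prems \<open>t \<le> l\<close> by (simp add: Suc_diff_Suc sum.atLeast_Suc_atMost)
    have "block l t m (l - s) = block l t m' (l - s)"
      using assms(3,4) Suc.prems by simp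
    then show ?case
      using Suc assms(3) unfolding * take_add by (simp add: block_def split: if_splits)
  qed simp
  then have "take (length m) m = take (length m) m'"
    unfolding assms(1) by blast
  then show ?thesis using assms(2) by simp
qed

section \<open>The support of a codeword\<close>

lemma inj_on_bit_pos:
  assumes "\<And>s. s < l \<Longrightarrow> offset l x s < 2 ^ l"
  shows "inj_on (bit_pos l x) {1..l}"
proof (rule inj_onI)
  fix i j assume "i \<in> {1..l}" "j \<in> {1..l}" "bit_pos l x i = bit_pos l x j"
  then have "offset l x (l - i) = offset l x (l - j)"
    using add_mod_cancel_left [of "dec (x l)" "offset l x (l - i)" "2 ^ l" "offset l x (l - j)"] assms
    by (simp add: bit_pos_eq)
  then have "l - i = l - j" using strict_mono_eq [OF strict_mono_offset] by blast
  then show "i = j" using \<open>i \<in> _\<close> \<open>j \<in> _\<close> by auto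
qed

lemma length_psi [simp]: "length (psi l t m) = 2 ^ l"
  by (simp add: psi_def Let_def)

text \<open>Injectivity on all \<open>l\<close> iterations matters: the final resets must not erase
  a bit set by one of the first \<open>t\<close> iterations.\<close>

lemma psi_support:
  assumes "inj_on (bit_pos l (block l t m)) {1..l}"
  shows "{i. i < 2 ^ l \<and> psi l t m ! i} = bit_pos l (block l t m) ` {l - t<..l}"
proof -
  let ?p = "bit_pos l (block l t m)"
  have "psi l t m ! i \<longleftrightarrow> i \<in> ?p ` {1..<l + 1} \<and> i \<notin> ?p ` {1..<l - t + 1}" if "i < 2 ^ l" for i
    using that by (simp add: psi_def Let_def nth_fold_list_update del: upt_Suc)
  moreover have "?p j < 2 ^ l" for j by (simp add: bit_pos_eq)
  ultimately have "{i. i < 2 ^ l \<and> psi l t m ! i} = ?p ` {1..<l + 1} - ?p ` {1..<l - t + 1}"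
    by auto
  also have "\<dots> = ?p ` ({1..<l + 1} - {1..<l - t + 1})"
    using assms by (subst inj_on_image_set_diff [where C = "{1..l}"]) auto
  also have "{1..<l + 1} - {1..<l - t + 1} = {l - t<..l}" by auto
  finally show ?thesis .
qed

lemma bit_pos_image:
  assumes "t \<le> l"
  shows "bit_pos l x ` {l - t<..l} = (\<lambda>s. (dec (x l) + offset l x s) mod 2 ^ l) ` {..<t}"
proof -
  have "{..<t} = (\<lambda>j. l - j) ` {l - t<..l}"
  proof (intro equalityI subsetI)
    fix s assume "s \<in> {..<t}"
    then show "s \<in> (\<lambda>j. l - j) ` {l - t<..l}"
      using assms by (intro image_eqI [of _ _ "l - s"]) auto
  qed (use assms in auto)
  then show ?thesis by (auto simp: image_image bit_pos_eq intro!: image_cong)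
qed

theorem mainTheorem10:
  fixes l t n k k_l :: nat and D :: "bool list set"
  assumes "l \<ge> 3" and "1 \<le> t" and "t \<le> l - 1"
    and "n = 2 ^ l"
    and "k_l = (\<Sum>i = 1..l. f_seq l i)"
    and "k = k_l - (\<Sum>i = 1..l - t. f_seq l i)"
    and "D = psi l t ` binvecs k"
  shows "psi l t \<in> binvecs k \<rightarrow> binvecs n \<and>
    inj_on (psi l t) (binvecs k) \<and>
    (\<forall>c \<in> psi l t ` binvecs k. hamming_weight c = t) \<and>
    constant_weight_code D n t \<and>
    card D = 2 ^ k"
proof -
  have tl: "t \<le> l" "t < l" using assms by auto
  have k: "k = (\<Sum>i = l - t + 1..l. f_seq l i)"
    using assms(5,6) sum.ub_add_nat [of 1 "l - t" "f_seq l" t] tl by simp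
  obtain G where G: "\<And>j. j \<in> {1..<l} \<Longrightarrow> (2::nat) ^ f_seq l j \<le> G"
      "(\<Sum>j\<in>{1..<l}. 2 ^ f_seq l j) + G \<le> 2 ^ l"
    using f_seq_gap_bound [OF assms(1)] by blast
  have Gpos: "0 < G" using G(1) [of 1] assms(1)
    by (auto intro: less_le_trans [OF zero_less_power [of "2::nat"]])
  \<comment> \<open>Since \<open>t < l\<close>, a retained bit has \<open>s < t\<close> and so
    \<open>l - s >= 2\<close>: its offset avoids the positive term for \<open>j = 1\<close>, which
    makes the bound strict.\<close>
  have wrap: "(\<Sum>j\<in>{2..<l}. 2 ^ f_seq l j) + G < 2 ^ l"
  proof -
    have "{1..<l} = insert 1 {2..<l}" using assms(1) by auto
    then have "(\<Sum>j\<in>{1..<l}. 2 ^ f_seq l j) = 2 ^ f_seq l 1 + (\<Sum>j\<in>{2..<l}. 2 ^ f_seq l j :: nat)"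
      by simp
    moreover have "(2::nat) ^ f_seq l 1 > 0" by simp
    ultimately show ?thesis using G(2) by linarith
  qed
  define x where "x = block l t"
  have len: "length (x m j) = f_seq l j" if "m \<in> binvecs k" "j \<le> l" for m j
    using that tl k by (simp add: x_def binvecs_def length_block)
  have off_less: "offset l (x m) s < 2 ^ l" if "m \<in> binvecs k" "s < l" for m s
  proof -
    have "offset l (x m) s \<le> (\<Sum>j\<in>{l - s..<l}. 2 ^ f_seq l j)"
      using that by (intro offset_le) (auto intro: len)
    also have "\<dots> \<le> (\<Sum>j\<in>{1..<l}. 2 ^ f_seq l j)"
      using that by (intro sum_mono2) auto
    finally show ?thesis using G(2) Gpos by linarith
  qed
  have off_G: "offset l (x m) s + G < 2 ^ l" if "m \<in> binvecs k" "s < t" for m s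
  proof -
    have "offset l (x m) s \<le> (\<Sum>j\<in>{l - s..<l}. 2 ^ f_seq l j)"
      using that tl by (intro offset_le) (auto intro: len)
    also have "\<dots> \<le> (\<Sum>j\<in>{2..<l}. 2 ^ f_seq l j)"
      using that tl by (intro sum_mono2) auto
    finally show ?thesis using wrap by linarith
  qed
  have gap: "offset l (x m) (Suc s) \<le> offset l (x m) s + G" if "m \<in> binvecs k" "Suc s < t" for m s
    using that tl dec_less [of "x m (l - Suc s)"] len [of m "l - Suc s"] G(1) [of "l - Suc s"]
    by (simp add: Suc_le_eq)
  have mono: "strict_mono_on A (offset l (x m))" for A m
    using strict_mono_offset by (auto simp: strict_mono_on_def dest: strict_monoD)
  have inj_pos: "inj_on (bit_pos l (x m)) {1..l}" if "m \<in> binvecs k" for m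
    using that off_less by (intro inj_on_bit_pos)
  have supp: "{i. i < 2 ^ l \<and> psi l t m ! i} = bit_pos l (x m) ` {l - t<..l}" if "m \<in> binvecs k" for m
    using psi_support inj_pos [OF that] by (simp add: x_def)
  have weight: "hamming_weight (psi l t m) = t" if "m \<in> binvecs k" for m
  proof -
    have "inj_on (bit_pos l (x m)) {l - t<..l}"
      by (rule inj_on_subset [OF inj_pos [OF that]]) auto
    then show ?thesis
      using tl by (simp add: hamming_weight_def supp [OF that] card_image)
  qed
  have inj: "inj_on (psi l t) (binvecs k)"
  proof (rule inj_onI)
    fix m m' assume m: "m \<in> binvecs k" "m' \<in> binvecs k" and eq: "psi l t m = psi l t m'"
    have "(\<lambda>s. (dec (x m l) + offset l (x m) s) mod 2 ^ l) ` {..<t}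
        = (\<lambda>s. (dec (x m' l) + offset l (x m') s) mod 2 ^ l) ` {..<t}"
      using supp [OF m(1)] supp [OF m(2)] eq tl by (simp add: bit_pos_image)
    \<comment> \<open>The first block has length \<open>l\<close>, so the start points are residues
      already.\<close>
    moreover have "dec (x m l) < 2 ^ l" "dec (x m' l) < 2 ^ l"
      using dec_less [of "x m l"] dec_less [of "x m' l"] len [OF m(1), of l] len [OF m(2), of l]
      by auto
    ultimately have *: "dec (x m l) = dec (x m' l) \<and> (\<forall>s<t. offset l (x m) s = offset l (x m') s)"
      using m assms(2) off_G gap tl mono off_less
      by (intro cyclic_positions_unique [where G = G and n = "2 ^ l"]) auto
    have "x m j = x m' j" if j: "l - t < j" "j \<le> l" for j
    proof -
      have "dec (x m j) = dec (x m' j)"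
      proof (cases "j = l")
        case False
        \<comment> \<open>Block \<open>j\<close> is read off from
          \<open>offset (Suc s) - offset s = 1 + dec (x j)\<close>.\<close>
        define s where "s = l - Suc j"
        have "Suc s < t" "l - Suc s = j" using False j by (auto simp: s_def)
        then show ?thesis using * [THEN conjunct2, rule_format, of s]
            * [THEN conjunct2, rule_format, of "Suc s"] by simp
      qed (use * in simp)
      then show ?thesis using j len m by (simp add: dec_eq_iff)
    qed
    then show "m = m'"
      using m tl k by (intro block_inject [of m l t m']) (auto simp: x_def binvecs_def)
  qed
  have "card (binvecs k) = 2 ^ k"
    using card_lists_length_eq [of "UNIV :: bool set" k] by (simp add: binvecs_def)
  with inj have "card D = 2 ^ k"
    using assms(7) by (simp add: card_image)
  then show ?thesis
    using inj weight assms(4,7) by (auto simp: constant_weight_code_def binvecs_def)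
qed

end
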